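(* For every integer $d \geq 2$ there exists a uniformly distributed sequence $(z_n)_{n \in \mathbb{N}} \in \mathcal{U}$ with $$\lim_{n \to \infty} \frac{1}{n} \sum_{i=1}^{n} f_{\max}(z_i,z_{i+1},\ldots,z_{i+d-1}) = \frac{d-1}{d} = C_{f_{\max}}^d$$ and $$\lim_{n \to \infty} \frac{1}{n} \sum_{i=1}^{n} f_{\sum}(z_i,z_{i+1},\ldots,z_{i+d-1}) = \frac{d^2-1}{3} = C_{f_{\sum}}^d .$$
   Context: A sequence $(x_n)_{n\in\mathbb{N}}$ in $[0,1]$ is called uniformly distributed if for every interval $[a,b]\subseteq[0,1]$ one has $\lim_{n\to\infty}\frac1n\sum_{i=1}^n \mathbf{1}_{[a,b]}(x_i)=b-a$. $\mathcal{U}$ denotes the set of all uniformly distributed sequences in $[0,1]$. Write $[d]=\{1,\ldots,d\}$. The functions $f_{\max},f_{\sum}\colon[0,1]^d\to[0,\infty)$ are defined for $\mathbf{x}=(x_1,\ldots,x_d)$ by $f_{\max}(\mathbf{x})=\max_{i,j\in[d],\,i\neq j}|x_i-x_j|$ and $f_{\sum}(\mathbf{x})=\sum_{i,j\in[d]}|x_i-x_j|$ (sum over all ordered pairs $(i,j)\in[d]^2$). For continuous $f\colon[0,1]^d\to\mathbb{R}$, $$C_f^d := \sup_{\mathbf{x}^1,\ldots,\mathbf{x}^d \in \mathcal{U}} \ \limsup_{n \to \infty} \frac{1}{n} \sum_{i=1}^{n} f(x_i^1,x_i^2,\ldots,x_i^d),$$ where $x_i^j$ denotes the $i$-th element of the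 sequence $\mathbf{x}^j$. *)

theory Defs
  imports "HOL-Analysis.Analysis"
begin

(* Sequences are indexed by the positive integers: a function on nat represents one,
   and its value at 0 plays no role. *)

definition unif_dist_seqs :: "(nat \<Rightarrow> real) set"  ("\<U>") where
  "\<U> = {x. (\<forall>i\<ge>1. x i \<in> {0..1}) \<and>
           (\<forall>a b. 0 \<le> a \<and> a \<le> b \<and> b \<le> 1 \<longrightarrow>
              (\<lambda>n. (\<Sum>i=1..n. indicator {a..b} (x i)) / real n) \<longlonglongrightarrow> b - a)}"

(* A point of [0,1]^d is a function in {1..d} \<rightarrow>\<^sub>E {0..1}, hence the restrictions
   to {1..d} wherever a function of d variables is applied. *)

definition f_max :: "nat \<Rightarrow> (nat \<Rightarrow> real) \<Rightarrow> real" where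
  "f_max d x = Max {\<bar>x i - x j\<bar> | i j. i \<in> {1..d} \<and> j \<in> {1..d} \<and> i \<noteq> j}"

definition f_sum :: "nat \<Rightarrow> (nat \<Rightarrow> real) \<Rightarrow> real" where
  "f_sum d x = (\<Sum>i\<in>{1..d}. \<Sum>j\<in>{1..d}. \<bar>x i - x j\<bar>)"

(* x j i is the i-th element of the j-th sequence.  The value lies in ereal because
   the library's limsup and its unconditional suprema live in complete lattices;
   for continuous f the averages are bounded, so the value is finite. *)

definition C_sup :: "nat \<Rightarrow> ((nat \<Rightarrow> real) \<Rightarrow> real) \<Rightarrow> ereal" where
  "C_sup d f = (SUP x \<in> {1..d} \<rightarrow>\<^sub>E \<U>.
      limsup (\<lambda>n. ereal ((\<Sum>i=1..n. f (\<lambda>j\<in>{1..d}. x j i)) / real n)))"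

end

theory Submission
  imports Defs
begin

text \<open>
  The upper bounds come from a dual problem. Call \<phi> a potential for f if f(x) is at most
  the sum of \<phi>(x j) over all coordinates j. Along uniformly distributed sequences the mean
  of every \<phi>(x j) is the integral of \<phi>, so the mean of f cannot exceed d times that
  integral. The bound is attained by the windows of a single uniformly distributed sequence as
  soon as every window turns the inequality into an equality
  (\<open>C_sup_eq_by_potential\<close>).

  For both functions there is a potential that is tight at the same points: those that have
  exactly one coordinate in each of the d blocks [(r - 1)/d, r/d]
  (\<open>stratified_by\<close>). For the maximal distance the potential measures how far a
  coordinate reaches into the top or the bottom block. For the sum of distances it measures the
  distances to the d - 1 interior block boundaries k/d: a pair of coordinates of ranks p < q is
  separated by q - p thresholds, and replacing the sign that the rank prescribes at a threshold
  by the absolute value can only increase the sum (\<open>f_sum_by_thresholds\<close>). Both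
  potentials are combinations of hinges max 0 (y - a), whose means follow from those of
  indicators of intervals by a staircase approximation (\<open>unif_dist_mean_hinge\<close>).

  It remains to find a uniformly distributed sequence all of whose windows of length d are
  stratified. The van der Corput sequence in base d is one: its n-th term lies in the block
  given by the last digit of n, and d consecutive integers have d different last digits. It is
  self-similar, since the terms of index congruent to q modulo d form a copy of the whole
  sequence shrunk into block q. An initial segment [0, t] covers whole blocks and cuts at most
  one, so counting n terms reduces to counting n div d terms with an additional error of at most
  d. The discrepancy is therefore logarithmic (\<open>radical_inverse_discrepancy\<close>).
\<close>

section \<open>Means of real sequences\<close>

definition has_mean :: "(nat \<Rightarrow> real) \<Rightarrow> real \<Rightarrow> bool" where
  "has_mean F L \<longleftrightarrow> (\<lambda>n. (\<Sum>i=1..n. F i) / real n) \<longlonglongrightarrow> L"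

lemma has_mean_cong:
  assumes "\<And>i. i \<ge> 1 \<Longrightarrow> F i = G i"
  shows "has_mean F L \<longleftrightarrow> has_mean G L"
proof -
  have "(\<Sum>i=1..n. F i) = (\<Sum>i=1..n. G i)" for n
    by (rule sum.cong) (auto simp: assms)
  then show ?thesis by (simp add: has_mean_def)
qed

lemma has_mean_const: "has_mean (\<lambda>_. c) c"
proof -
  have "\<forall>\<^sub>F n in sequentially. c = (\<Sum>i=1..n. c) / real n"
    by (rule eventually_sequentiallyI[of 1]) simp
  with tendsto_const show ?thesis
    unfolding has_mean_def by (rule Lim_transform_eventually)
qed

lemma has_mean_add:
  assumes "has_mean F L" "has_mean G M"
  shows "has_mean (\<lambda>i. F i + G i) (L + M)"
  using tendsto_add[OF assms[unfolded has_mean_def]]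
  by (simp add: has_mean_def sum.distrib add_divide_distrib)

lemma has_mean_cmult:
  assumes "has_mean F L"
  shows "has_mean (\<lambda>i. c * F i) (c * L)"
  using tendsto_mult_left[OF assms[unfolded has_mean_def], of c]
  by (simp add: has_mean_def sum_distrib_left)

lemma has_mean_diff:
  assumes "has_mean F L" "has_mean G M"
  shows "has_mean (\<lambda>i. F i - G i) (L - M)"
  using has_mean_add[OF assms(1) has_mean_cmult[OF assms(2), of "-1"]] by simp

lemma has_mean_sum:
  assumes "\<And>k. k \<in> A \<Longrightarrow> has_mean (F k) (L k)"
  shows "has_mean (\<lambda>i. \<Sum>k\<in>A. F k i) (\<Sum>k\<in>A. L k)"
  using assms
  by (induction A rule: infinite_finite_induct)
     (auto intro: has_mean_add has_mean_const)

lemma has_mean_shift: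
  assumes "has_mean F L"
  shows "has_mean (\<lambda>i. F (i + k)) L"
proof -
  let ?S = "\<lambda>n. \<Sum>i=1..n. F i"
  have split: "(\<Sum>i=1..n. F (i + k)) = ?S (n + k) - ?S k" for n
    by (induction n) auto
  have "(\<lambda>n. ?S (n + k) / real (n + k) * ((real n + real k) / real n) - ?S k / real n)
      \<longlonglongrightarrow> L * 1 - 0"
  proof (intro tendsto_diff tendsto_mult)
    show "(\<lambda>n. ?S (n + k) / real (n + k)) \<longlonglongrightarrow> L"
      using assms unfolding has_mean_def by (rule LIMSEQ_ignore_initial_segment)
    have "\<forall>\<^sub>F n in sequentially. 1 + real k / real n = (real n + real k) / real n"
      by (rule eventually_sequentiallyI[of 1]) (simp add: field_simps)
    moreover have "(\<lambda>n. 1 + real k / real n) \<longlonglongrightarrow> 1 + 0"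
      by (intro tendsto_add tendsto_const lim_const_over_n)
    ultimately show "(\<lambda>n. (real n + real k) / real n) \<longlonglongrightarrow> 1"
      using Lim_transform_eventually by fastforce
    show "(\<lambda>n. ?S k / real n) \<longlonglongrightarrow> 0"
      by (rule lim_const_over_n)
  qed
  moreover have "\<forall>\<^sub>F n in sequentially.
      ?S (n + k) / real (n + k) * ((real n + real k) / real n) - ?S k / real n
      = (?S (n + k) - ?S k) / real n"
    by (rule eventually_sequentiallyI[of 1]) (simp add: diff_divide_distrib)
  ultimately have "(\<lambda>n. (?S (n + k) - ?S k) / real n) \<longlonglongrightarrow> L * 1 - 0"
    by (rule Lim_transform_eventually)
  then show ?thesis unfolding has_mean_def split by simp
qed

text \<open>
  Having a mean is a closed condition under uniform approximation. This is what passes from step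
  functions to continuous ones.
\<close>

lemma has_mean_uniform_approx:
  assumes "\<And>e. e > 0 \<Longrightarrow>
    \<exists>G M. has_mean G M \<and> (\<forall>i\<ge>1. \<bar>F i - G i\<bar> \<le> e) \<and> \<bar>M - L\<bar> \<le> e"
  shows "has_mean F L"
  unfolding has_mean_def
proof (rule LIMSEQ_I)
  fix e :: real assume "e > 0"
  then obtain G M where G: "has_mean G M" "\<forall>i\<ge>1. \<bar>F i - G i\<bar> \<le> e / 4" "\<bar>M - L\<bar> \<le> e / 4"
    using assms[of "e / 4"] by auto
  obtain N where N: "\<And>n. n \<ge> N \<Longrightarrow> norm ((\<Sum>i=1..n. G i) / real n - M) < e / 4"
    using LIMSEQ_D[OF G(1)[unfolded has_mean_def], of "e / 4"] \<open>e > 0\<close> by auto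
  have "norm ((\<Sum>i=1..n. F i) / real n - L) < e" if "n \<ge> max 1 N" for n
  proof -
    have n: "n \<ge> 1" "n \<ge> N" using that by auto
    have "\<bar>(\<Sum>i=1..n. F i) - (\<Sum>i=1..n. G i)\<bar> \<le> (\<Sum>i=1..n. \<bar>F i - G i\<bar>)"
      unfolding sum_subtractf[symmetric] by (rule sum_abs)
    also have "\<dots> \<le> (\<Sum>i=1..n. e / 4)"
      by (rule sum_mono) (use G(2) in auto)
    finally have "\<bar>(\<Sum>i=1..n. F i) - (\<Sum>i=1..n. G i)\<bar> \<le> real n * (e / 4)" by simp
    then have "\<bar>((\<Sum>i=1..n. F i) - (\<Sum>i=1..n. G i)) / real n\<bar> \<le> e / 4"
      using n by (simp add: abs_divide field_simps)
    then show ?thesis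
      using N[OF n(2)] G(3) \<open>e > 0\<close> unfolding diff_divide_distrib real_norm_def by linarith
  qed
  then show "\<exists>N. \<forall>n\<ge>N. norm ((\<Sum>i=1..n. F i) / real n - L) < e" by blast
qed

section \<open>Means along uniformly distributed sequences\<close>

lemma unif_dist_iff:
  "x \<in> \<U> \<longleftrightarrow> (\<forall>i\<ge>1. x i \<in> {0..1}) \<and>
    (\<forall>a b. 0 \<le> a \<and> a \<le> b \<and> b \<le> 1 \<longrightarrow> has_mean (\<lambda>i. indicator {a..b} (x i)) (b - a))"
  by (simp add: unif_dist_seqs_def has_mean_def)

lemma unif_dist_shift:
  assumes "x \<in> \<U>"
  shows "(\<lambda>i. x (i + k)) \<in> \<U>"
  using assms has_mean_shift[where k = k] unfolding unif_dist_iff by fastforce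

text \<open>
  On [a, 1] the hinge is the identity up to translation, and the staircase with N steps of
  height c/N rounds it down to a multiple of c/N. All steps are indicators of closed intervals
  ending in 1, so their means are given directly by the definition of uniform distribution.
\<close>

lemma staircase_approx_hinge:
  fixes a c y :: real and N :: nat
  assumes "0 \<le> a" "a \<le> 1" "y \<le> 1" "N \<ge> 1"
  defines "c \<equiv> 1 - a"
  shows "\<bar>max 0 (y - a) - c / N * (\<Sum>k=1..N. indicator {a + c * k / N..1} y)\<bar> \<le> c / N"
proof (cases "y \<le> a")
  case True
  have "c / N * (\<Sum>k=1..N. indicator {a + c * k / N..1} y) = (0::real)"
  proof (cases "c = 0")
    case False
    then have "c > 0" using assms by simp
    then have "y < a + c * k / N" if "k \<in> {1..N}" for k
      using that True by (smt (verit) atLeastAtMost_iff divide_pos_pos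
          mult_pos_pos of_nat_0_less_iff less_le_trans zero_less_one less_numeral_extra(1))
    then have "(\<Sum>k=1..N. indicator {a + c * k / N..1} y) = (\<Sum>k=1..N. (0::real))"
      by (intro sum.cong) (auto simp: indicator_def simp flip: not_less)
    then show ?thesis by simp
  qed simp
  moreover have "max 0 (y - a) = 0" "0 \<le> c / N" using True assms by auto
  ultimately show ?thesis by linarith
next
  case False
  then have c: "c > 0" using assms by simp
  \<comment> \<open>The height of the hinge in units of c/N; the staircase returns its floor.\<close>
  define w where "w = (y - a) * N / c"
  have w: "0 \<le> w" "w \<le> N"
    using False c assms by (auto simp: w_def field_simps)
  have "(\<Sum>k=1..N. indicator {a + c * k / N..1} y) = (\<Sum>k=1..N. if real k \<le> w then 1 else (0::real))"
    using c assms by (intro sum.cong) (auto simp: indicator_def w_def field_simps)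
  also have "\<dots> = real (card {k \<in> {1..N}. real k \<le> w})"
    by (simp flip: sum.inter_filter)
  also have "{k \<in> {1..N}. real k \<le> w} = {1..nat \<lfloor>w\<rfloor>}"
    using w by (auto simp: le_nat_floor le_nat_iff le_floor_iff)
  also have "real (card {1..nat \<lfloor>w\<rfloor>}) = \<lfloor>w\<rfloor>"
    using w by simp
  finally have S: "(\<Sum>k=1..N. indicator {a + c * k / N..1} y) = real_of_int \<lfloor>w\<rfloor>" .
  have "max 0 (y - a) = c / N * w"
    using False c assms by (simp add: w_def)
  then have "\<bar>max 0 (y - a) - c / N * (\<Sum>k=1..N. indicator {a + c * k / N..1} y)\<bar>
      = c / N * \<bar>w - \<lfloor>w\<rfloor>\<bar>"
    using c assms(4) unfolding S by (simp only: abs_mult flip: right_diff_distrib) simp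
  also have "\<dots> \<le> c / N * 1"
    using c assms by (intro mult_left_mono) (auto, linarith)
  finally show ?thesis by simp
qed

text \<open>
  The limit is the integral of the hinge over [0, 1]. Integrating the staircase instead gives
  the same value up to an error of order 1/N.
\<close>

lemma unif_dist_mean_hinge:
  assumes "x \<in> \<U>" "0 \<le> a" "a \<le> 1"
  shows "has_mean (\<lambda>i. max 0 (x i - a)) ((1 - a)\<^sup>2 / 2)"
proof (rule has_mean_uniform_approx)
  fix e :: real assume "e > 0"
  define c where "c = 1 - a"
  have c: "0 \<le> c" "c \<le> 1" using assms by (auto simp: c_def)
  obtain N :: nat where N: "1 / e < N" using reals_Archimedean2 by blast
  have "0 < 1 / e" using \<open>e > 0\<close> by simp
  with N have N0: "N \<ge> 1" by (cases N) auto
  have Ne: "1 / N \<le> e" using N N0 \<open>e > 0\<close> by (simp add: field_simps)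
  then have cNe: "c / N \<le> e"
    using c N0 by (smt (verit) divide_right_mono of_nat_0_le_iff)
  let ?G = "\<lambda>i. c / N * (\<Sum>k=1..N. indicator {a + c * k / N..1} (x i))"
  let ?M = "c / N * (\<Sum>k=1..N. 1 - (a + c * k / N))"
  have "has_mean ?G ?M"
  proof (intro has_mean_cmult has_mean_sum)
    fix k assume k: "k \<in> {1..N}"
    have "c * k \<le> c * N" using k c by (intro mult_left_mono) auto
    then have "c * k / N \<le> c" using N0 by (simp add: field_simps)
    then have "0 \<le> a + c * k / N" "a + c * k / N \<le> 1" using assms c by (auto simp: c_def)
    then show "has_mean (\<lambda>i. indicator {a + c * k / N..1} (x i)) (1 - (a + c * k / N))"
      using assms(1) unfolding unif_dist_iff by blast
  qed
  moreover have "\<forall>i\<ge>1. \<bar>max 0 (x i - a) - ?G i\<bar> \<le> e"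
  proof (intro allI impI)
    fix i :: nat assume "i \<ge> 1"
    then have "x i \<le> 1" using assms(1) unfolding unif_dist_iff by auto
    then show "\<bar>max 0 (x i - a) - ?G i\<bar> \<le> e"
      using staircase_approx_hinge[OF assms(2,3) _ N0, of "x i"] cNe unfolding c_def by linarith
  qed
  moreover have "\<bar>?M - (1 - a)\<^sup>2 / 2\<bar> \<le> e"
  proof -
    have "(\<Sum>k=1..N. real k) = real N * (real N + 1) / 2"
      by (induction N) (auto simp: field_simps)
    moreover have "(\<Sum>k=1..N. 1 - (a + c * k / N)) = (\<Sum>k=1..N. c - c / N * real k)"
      by (simp add: c_def algebra_simps)
    ultimately have "(\<Sum>k=1..N. 1 - (a + c * k / N)) = N * c - c / N * (real N * (real N + 1) / 2)"
      by (simp only: sum_subtractf sum_distrib_left[symmetric]) simp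
    then have "?M = c / N * (N * c - c / N * (real N * (real N + 1) / 2))" by simp
    then have "?M - (1 - a)\<^sup>2 / 2 = - (c * c / (2 * N))"
      unfolding c_def[symmetric] using N0 by (simp add: power2_eq_square field_simps)
    moreover have "c * c / (2 * N) \<le> 1 / N"
      using c N0 mult_le_one[of c c] by (simp add: field_simps)
    moreover have "0 \<le> c * c / (2 * N)" using c by simp
    ultimately show ?thesis using Ne by linarith
  qed
  ultimately show "\<exists>G M. has_mean G M \<and> (\<forall>i\<ge>1. \<bar>max 0 (x i - a) - G i\<bar> \<le> e) \<and>
      \<bar>M - (1 - a)\<^sup>2 / 2\<bar> \<le> e" by blast
qed

lemma unif_dist_mean_id:
  assumes "x \<in> \<U>"
  shows "has_mean x (1 / 2)"
proof -
  have "has_mean (\<lambda>i. max 0 (x i - 0)) ((1 - 0)\<^sup>2 / 2)"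
    using assms by (rule unif_dist_mean_hinge) auto
  moreover have "max 0 (x i - 0) = x i" if "i \<ge> 1" for i
    using that assms by (auto simp: unif_dist_iff)
  ultimately show ?thesis using has_mean_cong[of "\<lambda>i. max 0 (x i - 0)" x] by simp
qed

lemma unif_dist_mean_hinge_left:
  assumes "x \<in> \<U>" "0 \<le> a" "a \<le> 1"
  shows "has_mean (\<lambda>i. max 0 (a - x i)) (a\<^sup>2 / 2)"
proof -
  \<comment> \<open>The positive part minus the number itself is the negative part.\<close>
  have "has_mean (\<lambda>i. max 0 (x i - a) - x i + a) ((1 - a)\<^sup>2 / 2 - 1 / 2 + a)"
    by (intro has_mean_add has_mean_diff has_mean_const unif_dist_mean_hinge unif_dist_mean_id assms)
  also have "(\<lambda>i. max 0 (x i - a) - x i + a) = (\<lambda>i. max 0 (a - x i))"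
    by (auto simp: max_def)
  also have "(1 - a)\<^sup>2 / 2 - 1 / 2 + a = a\<^sup>2 / 2"
    by (simp add: power2_eq_square field_simps)
  finally show ?thesis .
qed

lemma unif_dist_mean_dist:
  assumes "x \<in> \<U>" "0 \<le> a" "a \<le> 1"
  shows "has_mean (\<lambda>i. \<bar>x i - a\<bar>) ((1 - a)\<^sup>2 / 2 + a\<^sup>2 / 2)"
proof -
  have "has_mean (\<lambda>i. max 0 (x i - a) + max 0 (a - x i)) ((1 - a)\<^sup>2 / 2 + a\<^sup>2 / 2)"
    by (intro has_mean_add unif_dist_mean_hinge unif_dist_mean_hinge_left assms)
  also have "(\<lambda>i. max 0 (x i - a) + max 0 (a - x i)) = (\<lambda>i. \<bar>x i - a\<bar>)"
    by (auto simp: max_def)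
  finally show ?thesis .
qed

section \<open>Potentials and the extremal problem\<close>

text \<open>
  Weak duality with a matching pair. The potential bounds the mean of f for all families of
  uniformly distributed sequences because its own mean depends only on the marginals; the d
  shifts of z form one such family, and for it the bound is an equality.
\<close>

lemma C_sup_eq_by_potential:
  fixes f :: "(nat \<Rightarrow> real) \<Rightarrow> real"
  assumes mean: "\<And>x. x \<in> \<U> \<Longrightarrow> has_mean (\<lambda>i. \<phi> (x i)) I"
    and bound: "\<And>x. x \<in> {1..d} \<rightarrow>\<^sub>E {0..1} \<Longrightarrow> f x \<le> (\<Sum>j=1..d. \<phi> (x j))"
    and z: "z \<in> \<U>"
    and tight: "\<And>i. i \<ge> 1 \<Longrightarrow>
      f (\<lambda>j\<in>{1..d}. z (i + j - 1)) = (\<Sum>j=1..d. \<phi> (z (i + j - 1)))"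
  shows "has_mean (\<lambda>i. f (\<lambda>j\<in>{1..d}. z (i + j - 1))) (d * I)"
    and "ereal (d * I) = C_sup d f"
proof -
  let ?A = "\<lambda>x n. (\<Sum>i=1..n. f (\<lambda>j\<in>{1..d}. x j i)) / real n"
  define w where "w = (\<lambda>j\<in>{1..d}. \<lambda>i. z (i + j - 1))"
  have "w j \<in> \<U>" if "j \<in> {1..d}" for j
    using unif_dist_shift[OF z, of "j - 1"] that by (simp add: w_def)
  then have w: "w \<in> {1..d} \<rightarrow>\<^sub>E \<U>" by (auto simp: w_def)
  have marginal: "has_mean (\<lambda>i. \<Sum>j=1..d. \<phi> (x j i)) (d * I)" if "x \<in> {1..d} \<rightarrow>\<^sub>E \<U>" for x
    using has_mean_sum[of "{1..d}" "\<lambda>j i. \<phi> (x j i)" "\<lambda>_. I"] mean that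
    by (fastforce simp: PiE_iff)
  have window: "(\<lambda>j\<in>{1..d}. w j i) = (\<lambda>j\<in>{1..d}. z (i + j - 1))" for i
    by (auto simp: w_def)
  have "has_mean (\<lambda>i. f (\<lambda>j\<in>{1..d}. z (i + j - 1))) (d * I)
      \<longleftrightarrow> has_mean (\<lambda>i. \<Sum>j=1..d. \<phi> (w j i)) (d * I)"
  proof (rule has_mean_cong)
    fix i :: nat assume "i \<ge> 1"
    have "(\<Sum>j=1..d. \<phi> (w j i)) = (\<Sum>j=1..d. \<phi> (z (i + j - 1)))"
      by (rule sum.cong) (auto simp: w_def)
    with tight[OF \<open>i \<ge> 1\<close>]
    show "f (\<lambda>j\<in>{1..d}. z (i + j - 1)) = (\<Sum>j=1..d. \<phi> (w j i))" by simp
  qed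
  with marginal[OF w] show lim: "has_mean (\<lambda>i. f (\<lambda>j\<in>{1..d}. z (i + j - 1))) (d * I)" by simp
  show "ereal (d * I) = C_sup d f"
  proof (rule antisym)
    have "?A w \<longlonglongrightarrow> d * I"
      using lim unfolding has_mean_def window .
    then have "limsup (\<lambda>n. ereal (?A w n)) = ereal (d * I)"
      by (intro lim_imp_Limsup) auto
    then show "ereal (d * I) \<le> C_sup d f"
      unfolding C_sup_def by (intro SUP_upper2[OF w]) simp
    show "C_sup d f \<le> ereal (d * I)"
      unfolding C_sup_def
    proof (rule SUP_least)
      fix x assume x: "x \<in> {1..d} \<rightarrow>\<^sub>E \<U>"
      let ?B = "\<lambda>n. (\<Sum>i=1..n. \<Sum>j=1..d. \<phi> (x j i)) / real n"
      have "?A x n \<le> ?B n" for n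
      proof (intro divide_right_mono sum_mono)
        fix i assume i: "i \<in> {1..n}"
        have "x j i \<in> {0..1}" if "j \<in> {1..d}" for j
          using x that i by (auto simp: PiE_iff unif_dist_iff)
        then have "(\<lambda>j\<in>{1..d}. x j i) \<in> {1..d} \<rightarrow>\<^sub>E {0..1}" by auto
        from bound[OF this] show "f (\<lambda>j\<in>{1..d}. x j i) \<le> (\<Sum>j=1..d. \<phi> (x j i))" by simp
      qed simp
      then have "limsup (\<lambda>n. ereal (?A x n)) \<le> limsup (\<lambda>n. ereal (?B n))"
        by (intro Limsup_mono always_eventually) simp
      also have "\<dots> = ereal (d * I)"
        using marginal[OF x] unfolding has_mean_def by (intro lim_imp_Limsup) auto
      finally show "limsup (\<lambda>n. ereal (?A x n)) \<le> ereal (d * I)" .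
    qed
  qed
qed

text \<open>
  The d blocks are numbered 1 to d from left to right, and r assigns the coordinates to them. On
  a common boundary of two blocks either assignment is allowed, so r is a parameter.
\<close>

definition stratified_by :: "nat \<Rightarrow> (nat \<Rightarrow> nat) \<Rightarrow> (nat \<Rightarrow> real) \<Rightarrow> bool" where
  "stratified_by d r x \<longleftrightarrow> bij_betw r {1..d} {1..d} \<and>
    (\<forall>j\<in>{1..d}. (real (r j) - 1) / d \<le> x j \<and> x j \<le> r j / d)"

section \<open>The maximal distance\<close>

text \<open>
  The constant normalises the potential so that d copies of it contribute 1 - 2/d, the distance
  between the top and the bottom block.
\<close>

definition max_potential :: "nat \<Rightarrow> real \<Rightarrow> real" where
  "max_potential d y = max 0 (y - (1 - 1 / d)) + max 0 (1 / d - y) + (1 - 2 / d) / d"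

lemma f_max_ge:
  assumes "i \<in> {1..d}" "j \<in> {1..d}" "i \<noteq> j"
  shows "\<bar>x i - x j\<bar> \<le> f_max d x"
  unfolding f_max_def
proof (rule Max_ge)
  show "finite {\<bar>x i - x j\<bar> |i j. i \<in> {1..d} \<and> j \<in> {1..d} \<and> i \<noteq> j}"
    by (rule finite_subset[of _ "(\<lambda>(i, j). \<bar>x i - x j\<bar>) ` ({1..d} \<times> {1..d})"]) auto
qed (use assms in auto)

lemma f_max_le:
  assumes "d \<ge> 2"
    and "\<And>i j. i \<in> {1..d} \<Longrightarrow> j \<in> {1..d} \<Longrightarrow> i \<noteq> j \<Longrightarrow> x i - x j \<le> B"
  shows "f_max d x \<le> B"
  unfolding f_max_def
proof (rule Max.boundedI)
  show "finite {\<bar>x i - x j\<bar> |i j. i \<in> {1..d} \<and> j \<in> {1..d} \<and> i \<noteq> j}"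
    by (rule finite_subset[of _ "(\<lambda>(i, j). \<bar>x i - x j\<bar>) ` ({1..d} \<times> {1..d})"]) auto
  have "\<bar>x 1 - x 2\<bar> \<in> {\<bar>x i - x j\<bar> |i j. i \<in> {1..d} \<and> j \<in> {1..d} \<and> i \<noteq> j}"
    using assms(1) by (intro CollectI exI[of _ 1] exI[of _ 2]) auto
  then show "{\<bar>x i - x j\<bar> |i j. i \<in> {1..d} \<and> j \<in> {1..d} \<and> i \<noteq> j} \<noteq> {}" by blast
next
  fix a assume "a \<in> {\<bar>x i - x j\<bar> |i j. i \<in> {1..d} \<and> j \<in> {1..d} \<and> i \<noteq> j}"
  then show "a \<le> B" using assms(2) by (auto simp: abs_le_iff minus_diff_eq)
qed

text \<open>
  For any two coordinates the larger exceeds 1 - 1/d by at most its first hinge, and the smaller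
  falls short of 1/d by at most its second hinge. All other hinges are nonnegative.
\<close>

lemma f_max_le_potential:
  assumes "d \<ge> 2"
  shows "f_max d x \<le> (\<Sum>j=1..d. max_potential d (x j))"
proof (rule f_max_le[OF assms])
  fix i j assume ij: "i \<in> {1..d}" "j \<in> {1..d}" "i \<noteq> j"
  let ?h = "\<lambda>k. max 0 (x k - (1 - 1 / d)) + max 0 (1 / d - x k)"
  have "x i - x j - (1 - 2 / d) \<le> ?h i + ?h j"
    by (simp add: max_def)
  also have "\<dots> = (\<Sum>k\<in>{i, j}. ?h k)" using ij by simp
  also have "\<dots> \<le> (\<Sum>k=1..d. ?h k)"
    using ij by (intro sum_mono2) auto
  finally show "x i - x j \<le> (\<Sum>k=1..d. max_potential d (x k))"
    using assms by (simp add: max_potential_def sum.distrib)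
qed

text \<open>
  If every block is occupied once, only the coordinate p in the top block and the coordinate q in
  the bottom block can have nonzero hinges. These add up to x p - x q - (1 - 2/d), and the
  constants supply the missing 1 - 2/d.
\<close>

lemma f_max_eq_potential:
  assumes "d \<ge> 2" "stratified_by d r x"
  shows "f_max d x = (\<Sum>j=1..d. max_potential d (x j))"
proof (rule antisym[OF f_max_le_potential[OF assms(1)]])
  have r: "bij_betw r {1..d} {1..d}"
    and x: "\<And>j. j \<in> {1..d} \<Longrightarrow> (real (r j) - 1) / d \<le> x j \<and> x j \<le> r j / d"
    using assms(2) by (auto simp: stratified_by_def)
  have "d \<in> r ` {1..d}" unfolding bij_betw_imp_surj_on[OF r] using assms(1) by simp
  then obtain p where p: "p \<in> {1..d}" "r p = d" by (metis imageE)
  have "1 \<in> r ` {1..d}" unfolding bij_betw_imp_surj_on[OF r] using assms(1) by simp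
  then obtain q where q: "q \<in> {1..d}" "r q = 1" by (metis imageE)
  have rp: "r j = d \<longleftrightarrow> j = p" and rq: "r j = 1 \<longleftrightarrow> j = q" if "j \<in> {1..d}" for j
    using inj_on_eq_iff[OF bij_betw_imp_inj_on[OF r] that p(1)]
      inj_on_eq_iff[OF bij_betw_imp_inj_on[OF r] that q(1)] p(2) q(2) by simp_all
  have pot: "max_potential d (x j) = (if j = p then x p - (1 - 1 / d) else 0)
      + (if j = q then 1 / d - x q else 0) + (1 - 2 / d) / d" if j: "j \<in> {1..d}" for j
  proof -
    have rj: "r j \<in> {1..d}" using bij_betwE[OF r] j by blast
    have "max 0 (x j - (1 - 1 / d)) = (if j = p then x p - (1 - 1 / d) else 0)"
    proof (cases "j = p")
      case True
      then show ?thesis using x[OF j] p assms(1) by (auto simp: diff_divide_distrib)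
    next
      case False
      then have "r j \<le> d - 1" using rp[OF j] rj by auto
      then have "real (r j) \<le> real d - 1" using assms(1) by linarith
      then have "real (r j) / d \<le> (real d - 1) / d" by (intro divide_right_mono) auto
      then show ?thesis using False x[OF j] assms(1) by (auto simp: diff_divide_distrib)
    qed
    moreover have "max 0 (1 / d - x j) = (if j = q then 1 / d - x q else 0)"
    proof (cases "j = q")
      case True
      then show ?thesis using x[OF j] q by auto
    next
      case False
      then have "r j \<ge> 2" using rq[OF j] rj by auto
      then have "1 / d \<le> (real (r j) - 1) / d" by (intro divide_right_mono) auto
      then show ?thesis using False x[OF j] by auto
    qed
    ultimately show ?thesis by (simp add: max_potential_def)
  qed
  have "p \<noteq> q" using p q assms(1) by auto
  have "(\<Sum>j=1..d. max_potential d (x j)) = x p - x q"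
    using p q assms(1) by (simp add: pot sum.distrib)
  also have "\<dots> \<le> f_max d x"
    using f_max_ge[OF p(1) q(1) \<open>p \<noteq> q\<close>, of x] by linarith
  finally show "(\<Sum>j=1..d. max_potential d (x j)) \<le> f_max d x" .
qed

lemma mean_max_potential:
  assumes "d \<ge> 2" "x \<in> \<U>"
  shows "has_mean (\<lambda>i. max_potential d (x i)) ((real d - 1) / (real d)\<^sup>2)"
proof -
  have "has_mean (\<lambda>i. max_potential d (x i))
      ((1 - (1 - 1 / d))\<^sup>2 / 2 + (1 / d)\<^sup>2 / 2 + (1 - 2 / d) / d)"
    unfolding max_potential_def
    by (intro has_mean_add has_mean_const unif_dist_mean_hinge unif_dist_mean_hinge_left)
       (use assms in \<open>auto simp: field_simps\<close>)
  also have "(1 - (1 - 1 / d))\<^sup>2 / 2 + (1 / d)\<^sup>2 / 2 + (1 - 2 / d) / d = (real d - 1) / (real d)\<^sup>2"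
    using assms by (simp add: field_simps power2_eq_square)
  finally show ?thesis .
qed

section \<open>The sum of distances\<close>

text \<open>
  Up to an additive constant this is twice the sum of the distances to the interior block
  boundaries. As a function of y it is convex and piecewise linear with slope 2(2r - d - 1) on
  the r-th block, which is the coefficient of the r-th smallest coordinate in the sum of all
  distances.
\<close>

definition sum_potential :: "nat \<Rightarrow> real \<Rightarrow> real" where
  "sum_potential d y = 2 * (\<Sum>k::nat=1..<d. \<bar>y - k / d\<bar> + k / d * (1 - 2 * (k / d)))"

text \<open>
  Ties are broken arbitrarily, by adding the elements in the order of their values.
\<close>

lemma exists_ranking:
  fixes x :: "'a \<Rightarrow> real"
  assumes "finite S"
  shows "\<exists>r. bij_betw r S {1..card S} \<and> (\<forall>i\<in>S. \<forall>j\<in>S. r i < r j \<longrightarrow> x i \<le> x j)"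
  using assms
proof (induction S rule: finite_ranking_induct[where f = x])
  case empty
  then show ?case by (auto simp: bij_betw_def)
next
  case (insert m S)
  show ?case
  proof (cases "m \<in> S")
    case True
    then show ?thesis using insert by (simp add: insert_absorb)
  next
    case False
    from insert.IH obtain r where r: "bij_betw r S {1..card S}"
      "\<forall>i\<in>S. \<forall>j\<in>S. r i < r j \<longrightarrow> x i \<le> x j" by blast
    define r' where "r' = r(m := Suc (card S))"
    have *: "bij_betw r' S {1..card S}"
      using r(1) False by (subst bij_betw_cong[of _ _ r]) (auto simp: r'_def)
    have "bij_betw r' (S \<union> {m}) ({1..card S} \<union> {r' m})"
      using False * by (subst notIn_Un_bij_betw3[symmetric]) (auto simp: r'_def)
    moreover have "{1..card S} \<union> {r' m} = {1..card (insert m S)}"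
      using False insert.hyps by (auto simp: r'_def)
    moreover have "r' i < r' m" if "i \<in> S" for i
      using * that False by (auto simp: bij_betw_def r'_def less_Suc_eq_le)
    moreover have "x i \<le> x j" if "i \<in> insert m S" "j \<in> insert m S" "r' i < r' j" for i j
    proof (cases "j = m")
      case True
      then show ?thesis using that insert.hyps(2) by auto
    next
      case False
      then have "j \<in> S" using that by simp
      then have "i \<noteq> m" using \<open>\<And>i. i \<in> S \<Longrightarrow> r' i < r' m\<close>[of j] that(3) by auto
      then show ?thesis using False that r(2) by (auto simp: r'_def)
    qed
    ultimately show ?thesis by (intro exI[of _ r']) auto
  qed
qed

text \<open>
  The distance of two coordinates is their difference times the sign of the difference of their
  ranks. Collecting the signs in front of x j leaves the number of lower ranks minus the number
  of higher ones, (r j - 1) - (d - r j).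
\<close>

lemma f_sum_by_ranking:
  assumes r: "bij_betw r {1..d} {1..d}"
    and mono: "\<forall>i\<in>{1..d}. \<forall>j\<in>{1..d}. r i < r j \<longrightarrow> x i \<le> x j"
  shows "f_sum d x = 2 * (\<Sum>j=1..d. (2 * real (r j) - real d - 1) * x j)"
proof -
  let ?s = "\<lambda>i j. sgn (real (r i) - real (r j))"
  have inj: "r i = r j \<longleftrightarrow> i = j" if "i \<in> {1..d}" "j \<in> {1..d}" for i j
    by (rule inj_on_eq_iff[OF bij_betw_imp_inj_on[OF r] that])
  have "f_sum d x = (\<Sum>i=1..d. \<Sum>j=1..d. ?s i j * x i - ?s i j * x j)"
    unfolding f_sum_def
  proof (intro sum.cong refl)
    fix i j assume ij: "i \<in> {1..d}" "j \<in> {1..d}"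
    then show "\<bar>x i - x j\<bar> = ?s i j * x i - ?s i j * x j"
      using mono inj[OF ij]
      by (cases "r i" "r j" rule: linorder_cases) auto
  qed
  also have "\<dots> = (\<Sum>i=1..d. \<Sum>j=1..d. ?s i j * x i) - (\<Sum>i=1..d. \<Sum>j=1..d. ?s i j * x j)"
    by (simp add: sum_subtractf)
  also have "(\<Sum>i=1..d. \<Sum>j=1..d. ?s i j * x j) = (\<Sum>j=1..d. \<Sum>i=1..d. - (?s j i * x j))"
    by (subst sum.swap) (intro sum.cong refl, simp add: sgn_if)
  also have "(\<Sum>i=1..d. \<Sum>j=1..d. ?s i j * x i) - (\<Sum>j=1..d. \<Sum>i=1..d. - (?s j i * x j))
      = 2 * (\<Sum>i=1..d. (\<Sum>j=1..d. ?s i j) * x i)"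
    by (simp add: sum_negf sum_distrib_right)
  also have "(\<Sum>i=1..d. (\<Sum>j=1..d. ?s i j) * x i) = (\<Sum>i=1..d. (2 * real (r i) - real d - 1) * x i)"
  proof (intro sum.cong refl)
    fix i assume i: "i \<in> {1..d}"
    have ri: "r i \<in> {1..d}" using bij_betwE[OF r] i by blast
    have "(\<Sum>j=1..d. ?s i j) = (\<Sum>k=1..d. sgn (real (r i) - real k))"
      using sum.reindex_bij_betw[OF r, of "\<lambda>k. sgn (real (r i) - real k)"] by simp
    also have "\<dots> = 2 * real (r i) - real d - 1"
    proof -
      have "(\<Sum>k=1..n. sgn (real m - real k)) = (if m \<le> n then 2 * real m - real n - 1 else real n)"
        if "m \<ge> 1" for m n
        using that by (induction n) (auto simp: sgn_if)
      then show ?thesis using ri by simp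
    qed
    finally show "(\<Sum>j=1..d. ?s i j) * x i = (2 * real (r i) - real d - 1) * x i" by simp
  qed
  finally show ?thesis .
qed

text \<open>
  The coefficient 2 (r j) - d - 1 is split into d - 1 signs, one for each threshold k, positive
  when k < r j. Measuring the coordinates from k/d at threshold k changes the sum by a quantity
  that does not depend on r, since k of the d signs there are negative; the terms k/d * (1 -
  2k/d) restore it. In this form the sum of distances differs from the sum of the potentials
  only by absolute values.
\<close>

lemma f_sum_by_thresholds:
  assumes r: "bij_betw r {1..d} {1..d}"
    and mono: "\<forall>i\<in>{1..d}. \<forall>j\<in>{1..d}. r i < r j \<longrightarrow> x i \<le> x j"
  shows "f_sum d x = (\<Sum>j=1..d. 2 * (\<Sum>k::nat=1..<d.
    (if k < r j then x j - k / d else k / d - x j) + k / d * (1 - 2 * (k / d))))"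
proof -
  let ?s = "\<lambda>m k. if k < m then 1 else (-1::real)"
  have signs_k: "(\<Sum>k=1..<d. ?s m k) = 2 * real m - real d - 1" if "m \<in> {1..d}" for m
  proof -
    have "(\<Sum>k=1..<n. ?s m k) = (if m \<le> n then 2 * real m - real n - 1 else real n - 1)"
      if "m \<ge> 1" "n \<ge> 1" for m n
      using that(2,1) by (induction n rule: dec_induct) auto
    with that show ?thesis by simp
  qed
  have signs_m: "(\<Sum>m=1..d. ?s m k) = real d - 2 * real k" if "k \<in> {1..<d}" for k
  proof -
    have "(\<Sum>m=1..n. ?s m k) = (if k \<le> n then real n - 2 * real k else - real n)" for n
      by (induction n) auto
    then show ?thesis using that by simp
  qed
  have "(\<Sum>j=1..d. \<Sum>k=1..<d. ?s (r j) k * (k / d)) = (\<Sum>j=1..d. \<Sum>k=1..<d. k / d * (1 - 2 * (k / d)))"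
  proof -
    have "(\<Sum>j=1..d. \<Sum>k=1..<d. ?s (r j) k * (k / d)) = (\<Sum>m=1..d. \<Sum>k=1..<d. ?s m k * (k / d))"
      using sum.reindex_bij_betw[OF r, of "\<lambda>m. \<Sum>k=1..<d. ?s m k * (k / d)"] .
    also have "\<dots> = (\<Sum>k=1..<d. (\<Sum>m=1..d. ?s m k) * (k / d))"
      by (subst sum.swap) (simp only: sum_distrib_right)
    also have "\<dots> = (\<Sum>k=1..<d. (real d - 2 * real k) * (k / d))"
      by (intro sum.cong refl) (simp only: signs_m)
    also have "\<dots> = (\<Sum>k=1..<d. real d * (k / d * (1 - 2 * (k / d))))"
      by (intro sum.cong refl) (simp add: field_simps)
    also have "\<dots> = (\<Sum>j=1..d. \<Sum>k=1..<d. k / d * (1 - 2 * (k / d)))"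
      by (simp add: sum_distrib_left)
    finally show ?thesis .
  qed
  moreover have "(if k < r j then x j - k / d else k / d - x j)
      = ?s (r j) k * x j - ?s (r j) k * (k / d)" for j k
    by simp
  moreover have "f_sum d x = 2 * (\<Sum>j=1..d. \<Sum>k=1..<d. ?s (r j) k * x j)"
  proof -
    have "(\<Sum>j=1..d. (2 * real (r j) - real d - 1) * x j) = (\<Sum>j=1..d. (\<Sum>k=1..<d. ?s (r j) k) * x j)"
    proof (intro sum.cong refl)
      fix j assume "j \<in> {1..d}"
      then have "r j \<in> {1..d}" using bij_betwE[OF r] by blast
      then show "(2 * real (r j) - real d - 1) * x j = (\<Sum>k=1..<d. ?s (r j) k) * x j"
        by (simp only: signs_k)
    qed
    then show ?thesis by (simp only: f_sum_by_ranking[OF assms] sum_distrib_right)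
  qed
  ultimately show ?thesis
    by (simp only: sum.distrib sum_subtractf diff_add_cancel flip: sum_distrib_left)
qed

lemma f_sum_le_potential: "f_sum d x \<le> (\<Sum>j=1..d. sum_potential d (x j))"
proof -
  obtain r where r: "bij_betw r {1..d} {1..d}"
    and mono: "\<forall>i\<in>{1..d}. \<forall>j\<in>{1..d}. r i < r j \<longrightarrow> x i \<le> x j"
    using exists_ranking[of "{1..d}" x] by auto
  show ?thesis
    unfolding f_sum_by_thresholds[OF r mono] sum_potential_def
    by (intro sum_mono mult_left_mono add_right_mono) auto
qed

text \<open>
  In a stratified point the rank of a coordinate is its block, so k < r j means that x j is at
  least k/d, and otherwise it is at most k/d. The signs in \<open>f_sum_by_thresholds\<close> are then those of the
  absolute values.
\<close>

lemma f_sum_eq_potential: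
  assumes "stratified_by d r x"
  shows "f_sum d x = (\<Sum>j=1..d. sum_potential d (x j))"
proof -
  have r: "bij_betw r {1..d} {1..d}"
    and x: "\<And>j. j \<in> {1..d} \<Longrightarrow> (real (r j) - 1) / d \<le> x j \<and> x j \<le> r j / d"
    using assms by (auto simp: stratified_by_def)
  have mono: "\<forall>i\<in>{1..d}. \<forall>j\<in>{1..d}. r i < r j \<longrightarrow> x i \<le> x j"
  proof (intro ballI impI)
    fix i j assume that: "i \<in> {1..d}" "j \<in> {1..d}" "r i < r j"
    have "real (r i) / d \<le> (real (r j) - 1) / d" using that by (intro divide_right_mono) auto
    then show "x i \<le> x j" using x[OF that(1)] x[OF that(2)] by linarith
  qed
  have "(if k < r j then x j - k / d else k / d - x j) = \<bar>x j - k / d\<bar>" if "j \<in> {1..d}" for j k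
  proof (cases "k < r j")
    case True
    then have "real k / d \<le> (real (r j) - 1) / d" by (intro divide_right_mono) auto
    then show ?thesis using x[OF that] True by auto
  next
    case False
    then have "real (r j) / d \<le> real k / d" by (intro divide_right_mono) auto
    then show ?thesis using x[OF that] False by auto
  qed
  then show ?thesis
    unfolding f_sum_by_thresholds[OF r mono] sum_potential_def by (intro sum.cong refl) simp
qed

lemma mean_sum_potential:
  assumes "d \<ge> 1" "x \<in> \<U>"
  shows "has_mean (\<lambda>i. sum_potential d (x i)) (((real d)\<^sup>2 - 1) / (3 * d))"
proof -
  have "has_mean (\<lambda>i. sum_potential d (x i))
     (2 * (\<Sum>k::nat=1..<d. (1 - k / d)\<^sup>2 / 2 + (k / d)\<^sup>2 / 2 + k / d * (1 - 2 * (k / d))))"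
    unfolding sum_potential_def
    by (intro has_mean_cmult has_mean_sum has_mean_add has_mean_const unif_dist_mean_dist assms)
       (auto simp: field_simps)
  also have "2 * (\<Sum>k::nat=1..<d. (1 - k / d)\<^sup>2 / 2 + (k / d)\<^sup>2 / 2 + k / d * (1 - 2 * (k / d)))
      = (\<Sum>k=1..<d. 1 - 2 / (real d)\<^sup>2 * (real k)\<^sup>2)"
    unfolding sum_distrib_left
    by (intro sum.cong refl) (use assms in \<open>simp add: field_simps power2_eq_square\<close>)
  also have "\<dots> = (real d - 1) - 2 / (real d)\<^sup>2 * (\<Sum>k=1..<d. (real k)\<^sup>2)"
    using assms(1) by (simp only: sum_subtractf flip: sum_distrib_left) (simp add: of_nat_diff)
  also have "(\<Sum>k=1..<d. (real k)\<^sup>2) = (real d - 1) * real d * (2 * real d - 1) / 6"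
  proof -
    have "(\<Sum>k=1..<Suc n. (real k)\<^sup>2) = real n * (real n + 1) * (2 * real n + 1) / 6" for n
      by (induction n) (auto simp: field_simps power2_eq_square)
    from this[of "d - 1"] show ?thesis using assms(1) by (simp add: of_nat_diff algebra_simps)
  qed
  also have "2 / (real d)\<^sup>2 * ((real d - 1) * real d * (2 * real d - 1) / 6)
      = (real d - 1) * (2 * real d - 1) / (3 * d)"
    by (simp add: power2_eq_square)
  also have "(real d - 1) - (real d - 1) * (2 * real d - 1) / (3 * d) = ((real d)\<^sup>2 - 1) / (3 * d)"
    using assms(1) by (simp add: field_simps power2_eq_square)
  finally show ?thesis .
qed

section \<open>The van der Corput sequence\<close>

text \<open>
  The base b digits of n reflected at the radix point. For b < 2 digits make no sense and the
  value is 0.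
\<close>

function radical_inverse :: "nat \<Rightarrow> nat \<Rightarrow> real" where
  "radical_inverse b n =
    (if b < 2 \<or> n = 0 then 0 else (real (n mod b) + radical_inverse b (n div b)) / b)"
  by pat_completeness auto
termination by (relation "Wellfounded.measure snd") auto

declare radical_inverse.simps [simp del]

lemma radical_inverse_rec:
  assumes "b \<ge> 2"
  shows "radical_inverse b n = (real (n mod b) + radical_inverse b (n div b)) / b"
  using assms by (cases "n = 0") (simp_all add: radical_inverse.simps[of b n] radical_inverse.simps[of b 0])

lemma radical_inverse_bounds:
  assumes "b \<ge> 2"
  shows "0 \<le> radical_inverse b n \<and> radical_inverse b n < 1"
proof (induction n rule: less_induct)
  case (less n)
  show ?case
  proof (cases "n = 0")
    case True
    then show ?thesis by (simp add: radical_inverse.simps)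
  next
    case False
    then have "n div b < n" using assms by simp
    note IH = less[OF this]
    have "n mod b < b" using assms by simp
    then have "real (n mod b) + 1 \<le> b" by linarith
    with IH show ?thesis using assms by (subst (1 2) radical_inverse_rec) auto
  qed
qed

text \<open>
  Among b consecutive indices with the same leading digits, the terms fall one into each block.
  Those in the s blocks left of t are below t, those in blocks to the right are not, and the one
  in the block of t is a copy of the term with index m, which has to be compared with the
  position of t inside its block. The relation R covers open and closed initial segments at
  once; for the open ones, the terms in the last of the s blocks stay below t even if t is
  its right end, because the terms of the sequence are below 1.
\<close>

lemma radical_inverse_count_rec:
  fixes R :: "real \<Rightarrow> real \<Rightarrow> bool" and t :: real
  assumes b: "b \<ge> 2" and R: "R = (<) \<or> R = (\<le>)" and t: "0 \<le> t" "t < 1"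
  defines "s \<equiv> nat \<lfloor>b * t\<rfloor>"
  shows "(\<Sum>i=m*b..<m*b+b. of_bool (R (radical_inverse b i) t))
    = real s + of_bool (R (radical_inverse b m) (b * t - s))"
proof -
  have s: "real s \<le> b * t" "b * t < real s + 1"
    using t b by (auto simp: s_def)
  have "b * t < b" using t b by simp
  with s have "s < b" by linarith
  let ?v = "radical_inverse b m"
  have v: "0 \<le> ?v" "?v < 1" using radical_inverse_bounds[OF b, of m] by auto
  have "(\<Sum>i=m*b..<m*b+b. of_bool (R (radical_inverse b i) t))
      = (\<Sum>q=0..<b. of_bool (R (radical_inverse b (q + m * b)) t) :: real)"
    using sum.shift_bounds_nat_ivl[of "\<lambda>i. of_bool (R (radical_inverse b i) t)" 0 "m * b" b]
    by (simp only: add_0_left add.commute[of "m * b" b])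
  also have "\<dots> = (\<Sum>q=0..<b. (if q < s then 1 else 0) + (if q = s then of_bool (R ?v (b * t - s)) else 0))"
  proof (intro sum.cong refl)
    fix q assume q: "q \<in> {0..<b}"
    have "radical_inverse b (q + m * b) = (real q + ?v) / b"
      using q b by (subst radical_inverse_rec) auto
    moreover have "R ((real q + ?v) / b) t \<longleftrightarrow> R (real q + ?v) (b * t)"
      using R b by (auto simp: field_simps)
    ultimately have "R (radical_inverse b (q + m * b)) t \<longleftrightarrow> R (real q + ?v) (b * t)" by simp
    moreover have "R (real q + ?v) (b * t)" if "q < s"
    proof -
      have "real q + 1 \<le> s" using that by linarith
      then show ?thesis using R s v by auto
    qed
    moreover have "\<not> R (real q + ?v) (b * t)" if "q > s"
    proof -
      have "real s + 1 \<le> q" using that by linarith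
      then show ?thesis using R s v by auto
    qed
    moreover have "R (real q + ?v) (b * t) \<longleftrightarrow> R ?v (b * t - s)" if "q = s"
      using R that by auto
    ultimately show "of_bool (R (radical_inverse b (q + m * b)) t)
        = (if q < s then 1 else 0) + (if q = s then of_bool (R ?v (b * t - s)) else (0::real))"
      by (cases q s rule: linorder_cases) auto
  qed
  also have "\<dots> = real s + of_bool (R ?v (b * t - s))"
  proof -
    have "{q. q < b \<and> q < s} = {..<s}" using \<open>s < b\<close> by auto
    then have "(\<Sum>q=0..<b. if q < s then 1 else 0) = real s"
      by (simp flip: sum.inter_filter)
    then show ?thesis using \<open>s < b\<close> by (simp add: sum.distrib)
  qed
  finally show ?thesis .
qed

text \<open>
  Each step from n to n div b costs at most b, the contribution of the incomplete last group of
  indices, and at least halves n because b is at least 2.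
\<close>

lemma radical_inverse_discrepancy:
  fixes R :: "real \<Rightarrow> real \<Rightarrow> bool"
  assumes b: "b \<ge> 2" and R: "R = (<) \<or> R = (\<le>)" and "0 \<le> t" "t < 1" "n \<ge> 1"
  shows "\<bar>(\<Sum>i<n. of_bool (R (radical_inverse b i) t)) - n * t\<bar> \<le> b * (1 + log 2 n)"
  using assms(3-)
proof (induction n arbitrary: t rule: less_induct)
  case (less n)
  define m q where "m = n div b" and "q = n mod b"
  have n: "n = m * b + q" and q: "q < b" using b by (auto simp: m_def q_def)
  define s where "s = nat \<lfloor>b * t\<rfloor>"
  define t' where "t' = b * t - s"
  have t': "0 \<le> t'" "t' < 1" using less.prems b by (simp_all add: t'_def s_def) linarith
  let ?F = "\<lambda>i t. of_bool (R (radical_inverse b i) t) :: real"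
  let ?E = "\<lambda>n t. (\<Sum>i<n. ?F i t) - n * t"
  have "(\<Sum>i<n. ?F i t) = (\<Sum>i<m*b. ?F i t) + (\<Sum>i=m*b..<n. ?F i t)"
    using sum.atLeastLessThan_concat[of 0 "m * b" n "\<lambda>i. ?F i t"] n
    by (simp add: lessThan_atLeast0)
  also have "(\<Sum>i<m*b. ?F i t) = (\<Sum>j<m. \<Sum>i=j*b..<j*b+b. ?F i t)"
    by (rule sum.nat_group[symmetric])
  also have "\<dots> = (\<Sum>j<m. real s + ?F j t')"
    unfolding s_def t'_def
    by (intro sum.cong refl radical_inverse_count_rec b R less.prems)
  also have "\<dots> = m * s + (\<Sum>j<m. ?F j t')" by (simp add: sum.distrib)
  finally have E: "?E n t = ?E m t' + ((\<Sum>i=m*b..<n. ?F i t) - q * t)"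
    by (simp add: n t'_def algebra_simps)
  have "(\<Sum>i=m*b..<n. ?F i t) \<le> (\<Sum>i=m*b..<n. 1)" by (rule sum_mono) auto
  then have "(\<Sum>i=m*b..<n. ?F i t) \<le> q" by (simp add: n)
  moreover have "0 \<le> (\<Sum>i=m*b..<n. ?F i t)" by (rule sum_nonneg) auto
  moreover have "0 \<le> q * t" "q * t \<le> q" using less.prems by (auto intro: mult_left_le)
  ultimately have rest: "\<bar>(\<Sum>i=m*b..<n. ?F i t) - q * t\<bar> \<le> b" using q by linarith
  show ?case
  proof (cases "m = 0")
    case True
    have "0 \<le> b * log 2 n" using less.prems by simp
    then show ?thesis using E rest True by (simp add: distrib_left)
  next
    case False
    then have m: "m \<ge> 1" by simp
    have "m < n" using b less.prems by (simp add: m_def)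
    have "m * 2 \<le> m * b" using b by simp
    then have "m * 2 \<le> n" using n by linarith
    then have "log 2 (m * 2) \<le> log 2 n" using m by (subst log_le_cancel_iff) auto
    then have "1 + log 2 m \<le> log 2 n" using m by (simp add: log_mult)
    then have "b * (1 + log 2 m) \<le> b * log 2 n" by (intro mult_left_mono) auto
    with less.IH[OF \<open>m < n\<close> t' m] E rest show ?thesis by (simp add: distrib_left)
  qed
qed

lemma radical_inverse_mean_below:
  fixes R :: "real \<Rightarrow> real \<Rightarrow> bool"
  assumes b: "b \<ge> 2" and R: "R = (<) \<or> R = (\<le>)" and t: "0 \<le> t" "t \<le> 1"
  shows "has_mean (\<lambda>i. of_bool (R (radical_inverse b i) t)) t"
proof (cases "t = 1")
  case True
  have "R (radical_inverse b i) 1" for i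
    using R radical_inverse_bounds[OF b, of i] by auto
  then show ?thesis using has_mean_const[of 1] by (simp add: True)
next
  case False
  let ?F = "\<lambda>i. of_bool (R (radical_inverse b i) t) :: real"
  have "(\<lambda>n. (\<Sum>i<n. ?F i) / real n - t) \<longlonglongrightarrow> 0"
  proof (rule Lim_null_comparison)
    show "\<forall>\<^sub>F n in sequentially. norm ((\<Sum>i<n. ?F i) / real n - t) \<le> b * (1 + log 2 n) / n"
    proof (rule eventually_sequentiallyI[of 1])
      fix n :: nat assume n: "n \<ge> 1"
      have "norm ((\<Sum>i<n. ?F i) / real n - t) = \<bar>((\<Sum>i<n. ?F i) - n * t) / n\<bar>"
        using n by (simp add: field_simps)
      also have "\<dots> = \<bar>(\<Sum>i<n. ?F i) - n * t\<bar> / n" by (simp add: abs_divide)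
      also have "\<dots> \<le> b * (1 + log 2 n) / n"
        using radical_inverse_discrepancy[OF b R, of t n] t False n by (intro divide_right_mono) auto
      finally show "norm ((\<Sum>i<n. ?F i) / real n - t) \<le> b * (1 + log 2 n) / n" .
    qed
    have "(\<lambda>n. b * (1 / real n + (ln (real n) / real n) / ln 2)) \<longlonglongrightarrow> b * (0 + 0 / ln 2)"
      by (intro tendsto_intros lim_const_over_n lim_ln_over_n) auto
    moreover have "b * (1 / real n + (ln (real n) / real n) / ln 2) = b * (1 + log 2 n) / n" for n
      by (simp add: log_def add_divide_distrib distrib_left)
    ultimately show "(\<lambda>n. b * (1 + log 2 n) / n) \<longlonglongrightarrow> 0" by simp
  qed
  then have "(\<lambda>n. (\<Sum>i<n. ?F i) / real n) \<longlonglongrightarrow> t" by (simp add: LIM_zero_iff)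
  \<comment> \<open>The count starts at index 0, the mean at index 1; a shift by one makes up for it.\<close>
  moreover have "(\<Sum>i=1..n. ?F (i - 1)) = (\<Sum>i<n. ?F i)" for n
    by (induction n) auto
  ultimately have "has_mean (\<lambda>i. ?F (i - 1)) t" by (simp add: has_mean_def)
  from has_mean_shift[OF this, of 1] show ?thesis by simp
qed

lemma radical_inverse_unif_dist:
  assumes "b \<ge> 2"
  shows "radical_inverse b \<in> \<U>"
  unfolding unif_dist_iff
proof (intro conjI allI impI)
  show "radical_inverse b i \<in> {0..1}" for i
    using radical_inverse_bounds[OF assms, of i] by auto
next
  fix u v :: real assume uv: "0 \<le> u \<and> u \<le> v \<and> v \<le> 1"
  have "has_mean (\<lambda>i. of_bool (radical_inverse b i \<le> v) - of_bool (radical_inverse b i < u)) (v - u)"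
    by (intro has_mean_diff radical_inverse_mean_below assms) (use uv in auto)
  also have "(\<lambda>i. of_bool (radical_inverse b i \<le> v) - of_bool (radical_inverse b i < u))
      = (\<lambda>i. indicator {u..v} (radical_inverse b i) :: real)"
    using uv by (auto simp: indicator_def fun_eq_iff)
  finally show "has_mean (\<lambda>i. indicator {u..v} (radical_inverse b i)) (v - u)" .
qed

text \<open>
  The last digit of the index determines the block, and d consecutive indices have distinct last
  digits.
\<close>

lemma radical_inverse_windows_stratified:
  assumes "d \<ge> 2"
  shows "stratified_by d (\<lambda>j. (i + j - 1) mod d + 1) (\<lambda>j\<in>{1..d}. radical_inverse d (i + j - 1))"
  unfolding stratified_by_def
proof (intro conjI ballI)
  have "inj_on (\<lambda>j. (i + j - 1) mod d + 1) {1..d}"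
  proof (rule linorder_inj_onI)
    fix j k assume jk: "j < k" "j \<in> {1..d}" "k \<in> {1..d}"
    have "\<not> d dvd (i + k - 1) - (i + j - 1)"
      using jk by (auto dest: dvd_imp_le)
    then show "(i + j - 1) mod d + 1 \<noteq> (i + k - 1) mod d + 1"
      using jk by (metis add_right_cancel mod_eq_dvd_iff_nat diff_le_mono add_left_mono less_imp_le)
  qed auto
  moreover have "(\<lambda>j. (i + j - 1) mod d + 1) ` {1..d} \<subseteq> {1..d}"
    using assms by (auto simp: Suc_le_eq)
  ultimately show "bij_betw (\<lambda>j. (i + j - 1) mod d + 1) {1..d} {1..d}"
    by (simp add: bij_betw_def endo_inj_surj)
next
  fix j assume "j \<in> {1..d}"
  then show "(real ((i + j - 1) mod d + 1) - 1) / d \<le> (\<lambda>j\<in>{1..d}. radical_inverse d (i + j - 1)) j"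
    and "(\<lambda>j\<in>{1..d}. radical_inverse d (i + j - 1)) j \<le> real ((i + j - 1) mod d + 1) / d"
    using radical_inverse_rec[OF assms, of "i + j - 1"]
      radical_inverse_bounds[OF assms, of "(i + j - 1) div d"]
    by (auto intro!: divide_right_mono)
qed

section \<open>The extremal sequence\<close>

theorem proposition5p1:
  fixes d :: nat
  assumes "d \<ge> 2"
  shows "\<exists>z \<in> \<U>.
    ((\<lambda>n. (\<Sum>i=1..n. f_max d (\<lambda>j\<in>{1..d}. z (i + j - 1))) / real n)
        \<longlonglongrightarrow> (real d - 1) / real d) \<and>
    ereal ((real d - 1) / real d) = C_sup d (f_max d) \<and>
    ((\<lambda>n. (\<Sum>i=1..n. f_sum d (\<lambda>j\<in>{1..d}. z (i + j - 1))) / real n)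
        \<longlonglongrightarrow> ((real d)\<^sup>2 - 1) / 3) \<and>
    ereal (((real d)\<^sup>2 - 1) / 3) = C_sup d (f_sum d)"
proof -
  let ?z = "radical_inverse d"
  have z: "?z \<in> \<U>" by (rule radical_inverse_unif_dist[OF assms])
  note strat = radical_inverse_windows_stratified[OF assms]
  have tight_max: "f_max d (\<lambda>j\<in>{1..d}. ?z (i + j - 1)) = (\<Sum>j=1..d. max_potential d (?z (i + j - 1)))" for i
    unfolding f_max_eq_potential[OF assms strat] by (rule sum.cong) auto
  have tight_sum: "f_sum d (\<lambda>j\<in>{1..d}. ?z (i + j - 1)) = (\<Sum>j=1..d. sum_potential d (?z (i + j - 1)))" for i
    unfolding f_sum_eq_potential[OF strat] by (rule sum.cong) auto
  have d1: "d \<ge> 1" using assms by simp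
  have vals: "d * ((real d - 1) / (real d)\<^sup>2) = (real d - 1) / d"
    "d * (((real d)\<^sup>2 - 1) / (3 * d)) = ((real d)\<^sup>2 - 1) / 3"
    using assms by (auto simp: power2_eq_square)
  note max_case = C_sup_eq_by_potential[where f = "f_max d",
      OF mean_max_potential[OF assms] f_max_le_potential[OF assms] z tight_max, unfolded vals]
  note sum_case = C_sup_eq_by_potential[where f = "f_sum d",
      OF mean_sum_potential[OF d1] f_sum_le_potential z tight_sum, unfolded vals]
  show ?thesis
    using z max_case sum_case unfolding has_mean_def by blast
qed

end
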